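(* Let $G\subset\mathbb{C}$ be a domain with an isolated boundary point $z_0\in\mathbb{C}$ and hyperbolic metric $\lambda_G(z)\,|dz|$. Then $$\lim_{z\to z_0}\left(|z-z_0|\log\frac{1}{|z-z_0|}\right)\lambda_G(z)=1 .$$
   Context: A conformal pseudo-metric $\lambda(z)\,|dz|$ on $G$ is given by a continuous function $\lambda:G\to[0,+\infty)$, $\lambda\not\equiv 0$ (its density). For a continuous real-valued function $u$ near a point $z$, the generalized lower Laplace operator is $\Delta u(z)=\liminf_{r\to 0}\frac{4}{r^2}\left(\frac{1}{2\pi}\int_0^{2\pi}u(z+re^{it})\,dt-u(z)\right)$. Where $\lambda(z)>0$ the curvature is $\kappa_\lambda(z)=-\Delta(\log\lambda)(z)/\lambda(z)^2$. The pseudo-metric is an SK-metric on $G$ if $\kappa_\lambda\le -1$ at every point where $\lambda>0$. If $G$ carries at least one SK-metric, the hyperbolic metric $\lambda_G(z)\,|dz|$ of $G$ is the maximal SK-metric on $G$, i.e. $\lambda_G(z)=\sup\{\lambda(z): \lambda(z)\,|dz| \text{ an SK-metric on } G\}$; it is a $C^2$ positive density with curvature identically $-1$. "Having a hyperbolic metric" means that $G$ carries at least one SK-metric. *)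

theory Defs
  imports "HOL-Analysis.Analysis"
begin

text \<open>
  The lower limit is taken in the extended reals, so that the values $\pm\infty$ are allowed.
\<close>

definition lower_laplace :: "(complex \<Rightarrow> real) \<Rightarrow> complex \<Rightarrow> ereal" where
  "lower_laplace u z =
     Liminf (at_right 0) (\<lambda>r. ereal (4 / r\<^sup>2 *
       (1 / (2 * pi) * integral {0..2 * pi} (\<lambda>t. u (z + of_real r * cis t)) - u z)))"

text \<open>
  A density on \<open>G\<close> is represented by a total function on the complex plane of which only
  the values on \<open>G\<close> matter.
\<close>

definition conformal_pseudo_metric :: "complex set \<Rightarrow> (complex \<Rightarrow> real) \<Rightarrow> bool" where
  "conformal_pseudo_metric G \<mu> \<longleftrightarrow>
     continuous_on G \<mu> \<and> (\<forall>z\<in>G. \<mu> z \<ge> 0) \<and> (\<exists>z\<in>G. \<mu> z \<noteq> 0)"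

text \<open>
  Only meaningful at interior points of \<open>G\<close> with \<open>\<mu> z > 0\<close>: there \<open>\<mu>\<close> is positive on a
  neighbourhood of \<open>z\<close>, so that \<open>ln (\<mu> w)\<close> is a continuous real function near \<open>z\<close>.
\<close>

definition curvature :: "(complex \<Rightarrow> real) \<Rightarrow> complex \<Rightarrow> ereal" where
  "curvature \<mu> z = - lower_laplace (\<lambda>w. ln (\<mu> w)) z / ereal ((\<mu> z)\<^sup>2)"

definition SK_metric :: "complex set \<Rightarrow> (complex \<Rightarrow> real) \<Rightarrow> bool" where
  "SK_metric G \<mu> \<longleftrightarrow>
     conformal_pseudo_metric G \<mu> \<and> (\<forall>z\<in>G. \<mu> z > 0 \<longrightarrow> curvature \<mu> z \<le> -1)"

definition has_hyperbolic_metric :: "complex set \<Rightarrow> bool" where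
  "has_hyperbolic_metric G \<longleftrightarrow> (\<exists>\<mu>. SK_metric G \<mu>)"

text \<open>
  For open \<open>G\<close> and \<open>z \<in> G\<close> the set below is bounded above (Ahlfors' lemma on a disk around \<open>z\<close>
  inside \<open>G\<close>), and it is nonempty if \<open>has_hyperbolic_metric G\<close>; so the supremum in the reals is
  the true one.
\<close>

definition hyperbolic_metric :: "complex set \<Rightarrow> complex \<Rightarrow> real" where
  "hyperbolic_metric G z = Sup {\<mu> z |\<mu>. SK_metric G \<mu>}"

end

theory Submission
  imports Defs "HOL-Real_Asymp.Real_Asymp"
begin

text \<open>
  Near an isolated boundary point \<open>z0\<close> the domain contains a punctured disc
  \<open>0 < \<bar>z - z0\<bar> \<le> R\<close>, and the metric is squeezed between two densities of the form
  \<open>1 / (\<bar>z - z0\<bar> (K - log \<bar>z - z0\<bar>))\<close>. Multiplied by \<open>\<bar>z - z0\<bar> log (1 / \<bar>z - z0\<bar>)\<close>, such a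
  density tends to 1 whatever the constant \<open>K\<close> is, which gives the limit.

  The upper bound, with \<open>K = log R\<close>, is the Ahlfors principle. An arbitrary SK-metric is compared with
  the hyperbolic density of the annulus \<open>R e\<^sup>-\<^sup>L < \<bar>z - z0\<bar> < R\<close>, which tends to infinity
  at the boundary: a quotient exceeding 1 would attain its maximum inside the annulus, and there the
  curvature inequality is violated (\<open>SK_metric_le_annulus\<close>). Letting \<open>L\<close> tend to infinity
  leaves the density of the punctured disc (\<open>SK_metric_le_punctured_disc\<close>).

  The lower bound needs a competitor in the supremum. The same comparison, with annuli that
  exhaust the plane punctured at \<open>z0\<close>, shows that the latter carries no SK-metric
  (\<open>no_SK_metric_punctured_plane\<close>); as \<open>G\<close> carries one, it omits a second point \<open>z1\<close>. On the
  plane without \<open>z0\<close> and \<open>z1\<close> there is an explicit positive SK-metric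
  (\<open>twice_punctured_SK_metric\<close>). Its singularity at \<open>z0\<close>, of order \<open>\<bar>z - z0\<bar>\<^bsup>-5/6\<^esup>\<close>, is too weak, but it is
  positive on the circle of radius \<open>R\<close>; so the cusp density with a large constant \<open>K\<close> lies
  below it on that circle, and the maximum of both inside the circle, continued by the explicit
  metric outside, is an SK-metric with the desired cusp (\<open>cusp_lower_bound\<close>).

  Curvatures are computed pointwise: every density that occurs is built from radial functions, and
  a second order expansion at a point determines the lower Laplacian there
  (\<open>lower_laplace_eq\<close>). This replaces any theory of subharmonic functions, because for
  maxima and for gluing only the monotonicity of the lower Laplacian under touching is used.
\<close>

section \<open>Lower Laplacians from second order expansions\<close>

text \<open>
  Circle means see of a quadratic form in \<open>h\<close> only its coefficient \<open>c\<close> at \<open>\<bar>h\<bar>\<^sup>2\<close>, the harmonic part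
  \<open>Re (a h + b h\<^sup>2)\<close> having mean zero. Hence only \<open>c\<close> is a parameter. For a twice
  differentiable \<open>u\<close> the number \<open>4 c\<close> is the classical Laplacian.
\<close>

definition circle_expansion :: "(complex \<Rightarrow> real) \<Rightarrow> complex \<Rightarrow> real \<Rightarrow> bool" where
  "circle_expansion u z c \<longleftrightarrow>
     (\<exists>a b. \<forall>\<epsilon>>0. \<forall>\<^sub>F h in nhds 0.
        \<bar>u (z + h) - (u z + Re (a * h + b * h\<^sup>2) + c * (cmod h)\<^sup>2)\<bar> \<le> \<epsilon> * (cmod h)\<^sup>2)"

lemma circle_expansion_add:
  assumes "circle_expansion u z c" "circle_expansion v z d"
  shows "circle_expansion (\<lambda>w. u w + v w) z (c + d)"
proof -
  obtain a b where u: "\<And>e. e > 0 \<Longrightarrow> \<forall>\<^sub>F h in nhds 0.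
        \<bar>u (z + h) - (u z + Re (a * h + b * h\<^sup>2) + c * (cmod h)\<^sup>2)\<bar> \<le> e * (cmod h)\<^sup>2"
    using assms(1) unfolding circle_expansion_def by blast
  obtain a' b' where v: "\<And>e. e > 0 \<Longrightarrow> \<forall>\<^sub>F h in nhds 0.
        \<bar>v (z + h) - (v z + Re (a' * h + b' * h\<^sup>2) + d * (cmod h)\<^sup>2)\<bar> \<le> e * (cmod h)\<^sup>2"
    using assms(2) unfolding circle_expansion_def by blast
  have "\<forall>\<^sub>F h in nhds 0. \<bar>u (z + h) + v (z + h) -
          (u z + v z + Re ((a + a') * h + (b + b') * h\<^sup>2) + (c + d) * (cmod h)\<^sup>2)\<bar>
          \<le> e * (cmod h)\<^sup>2" if "e > 0" for e
  proof -
    have "e / 2 > 0" using that by simp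
    from u[OF this] v[OF this] show ?thesis
    proof eventually_elim
      case (elim h)
      have "Re ((a + a') * h + (b + b') * h\<^sup>2) = Re (a * h + b * h\<^sup>2) + Re (a' * h + b' * h\<^sup>2)"
        by (simp add: distrib_right)
      moreover have "(c + d) * (cmod h)\<^sup>2 = c * (cmod h)\<^sup>2 + d * (cmod h)\<^sup>2"
        by (simp add: distrib_right)
      moreover have "e / 2 * (cmod h)\<^sup>2 + e / 2 * (cmod h)\<^sup>2 = e * (cmod h)\<^sup>2" by simp
      ultimately show ?case using elim unfolding abs_le_iff by linarith
    qed
  qed
  then show ?thesis unfolding circle_expansion_def by blast
qed

lemma circle_expansion_const: "circle_expansion (\<lambda>w. k) z 0"
  unfolding circle_expansion_def by (rule exI[of _ 0], rule exI[of _ 0]) auto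

lemma integral_circle_quadratic:
  fixes a b :: complex and r k :: real
  shows "((\<lambda>t. k + Re (a * (of_real r * cis t) + b * (of_real r * cis t)\<^sup>2)) has_integral 2 * pi * k)
           {0..2 * pi}"
proof -
  define F where "F = (\<lambda>t. k * t + r * (Re a * sin t + Im a * cos t)
                          + r\<^sup>2 / 2 * (Re b * sin (2 * t) + Im b * cos (2 * t)))"
  have "((\<lambda>t. k + Re (a * (of_real r * cis t) + b * (of_real r * cis t)\<^sup>2)) has_integral
          (F (2 * pi) - F 0)) {0..2 * pi}"
  proof (rule fundamental_theorem_of_calculus)
    fix t :: real
    have 1: "k + Re (a * (of_real r * cis t) + b * (of_real r * cis t)\<^sup>2)
        = k + r * (Re a * cos t - Im a * sin t)
          + r\<^sup>2 * (Re b * cos (2 * t) - Im b * sin (2 * t))"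
      unfolding cos_double sin_double by (simp add: power2_eq_square algebra_simps)
    have "(F has_real_derivative (k + r * (Re a * cos t - Im a * sin t)
          + r\<^sup>2 * (Re b * cos (2 * t) - Im b * sin (2 * t)))) (at t)"
      unfolding F_def by (auto intro!: derivative_eq_intros simp: algebra_simps)
    then show "(F has_vector_derivative
        (k + Re (a * (of_real r * cis t) + b * (of_real r * cis t)\<^sup>2))) (at t within {0..2 * pi})"
      unfolding 1 has_real_derivative_iff_has_vector_derivative
      by (rule has_vector_derivative_at_within)
  qed auto
  moreover have "F (2 * pi) - F 0 = 2 * pi * k"
    using sin_int_times_real cos_int_times_real sin_periodic[of "2*pi"] cos_periodic[of "2*pi"]
    by (simp add: F_def)
  ultimately show ?thesis by simp
qed

lemma circle_in_ball: "0 < r \<Longrightarrow> r < e \<Longrightarrow> z + of_real r * cis t \<in> ball z e"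
  by (simp add: dist_norm norm_mult)

lemma integrable_on_circle:
  fixes u :: "complex \<Rightarrow> real"
  assumes "continuous_on (ball z e) u" "0 < r" "r < e"
  shows "(\<lambda>t. u (z + of_real r * cis t)) integrable_on {0..2 * pi}"
proof (rule integrable_continuous_real)
  have "continuous_on {0..2 * pi} (\<lambda>t. z + of_real r * cis t)"
    by (intro continuous_intros)
  then show "continuous_on {0..2 * pi} (\<lambda>t. u (z + of_real r * cis t))"
    by (rule continuous_on_compose2[OF assms(1)]) (use circle_in_ball[OF assms(2,3)] in auto)
qed

text \<open>
  The mean of the quadratic model over the circle of radius \<open>r\<close> is exactly \<open>u z + c r\<^sup>2\<close>, and the
  error \<open>o(r\<^sup>2)\<close> disappears after division by \<open>r\<^sup>2\<close>; so the lower limit is a limit.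
\<close>

lemma lower_laplace_eq:
  assumes e: "e > 0" and cont: "continuous_on (ball z e) u" and ex: "circle_expansion u z c"
  shows "lower_laplace u z = ereal (4 * c)"
proof -
  obtain a b where u: "\<And>e. e > 0 \<Longrightarrow> \<forall>\<^sub>F h in nhds 0.
        \<bar>u (z + h) - (u z + Re (a * h + b * h\<^sup>2) + c * (cmod h)\<^sup>2)\<bar> \<le> e * (cmod h)\<^sup>2"
    using ex unfolding circle_expansion_def by blast
  define A where "A = (\<lambda>r. 4 / r\<^sup>2 *
       (1 / (2 * pi) * integral {0..2 * pi} (\<lambda>t. u (z + of_real r * cis t)) - u z))"
  have "(A \<longlongrightarrow> 4 * c) (at_right 0)"
  proof (rule tendstoI)
    fix k :: real assume k: "k > 0"
    obtain d where d: "d > 0" and dd: "\<And>h. cmod h < d \<Longrightarrow>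
        \<bar>u (z + h) - (u z + Re (a * h + b * h\<^sup>2) + c * (cmod h)\<^sup>2)\<bar> \<le> k / 8 * (cmod h)\<^sup>2"
      using u[of "k/8"] k by (auto simp: eventually_nhds_metric dist_norm)
    have "dist (A r) (4 * c) < k" if r: "0 < r" "r < min d e" for r
    proof -
      let ?I = "integral {0..2 * pi} (\<lambda>t. u (z + of_real r * cis t))"
      let ?q = "\<lambda>t. (u z + c * r\<^sup>2) + Re (a * (of_real r * cis t) + b * (of_real r * cis t)\<^sup>2)"
      have i: "((\<lambda>t. u (z + of_real r * cis t)) has_integral ?I) {0..2*pi}"
        using integrable_on_circle[OF cont] r by (simp add: integrable_integral)
      have "((\<lambda>t. u (z + of_real r * cis t) - ?q t) has_integral (?I - 2*pi*(u z + c * r\<^sup>2))) {0..2*pi}"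
        by (rule has_integral_diff[OF i integral_circle_quadratic])
      moreover have "norm (u (z + of_real r * cis t) - ?q t) \<le> k / 8 * r\<^sup>2" for t
        using dd[of "of_real r * cis t"] r by (simp add: norm_mult algebra_simps)
      ultimately have "norm (?I - 2*pi*(u z + c * r\<^sup>2)) \<le> k / 8 * r\<^sup>2 * measure lborel {0..2*pi}"
        using k by (intro has_integral_bound_real[where f="\<lambda>t. u (z + of_real r * cis t) - ?q t"]) auto
      then have b: "\<bar>?I - 2*pi*(u z + c * r\<^sup>2)\<bar> \<le> k / 4 * r\<^sup>2 * pi" by (simp add: mult_ac)
      have "A r - 4 * c = 2 / (pi * r\<^sup>2) * (?I - 2*pi*(u z + c * r\<^sup>2))"
        using r by (simp add: A_def field_simps)
      moreover have "\<bar>2 / (pi * r\<^sup>2) * y\<bar> = 2 / (pi * r\<^sup>2) * \<bar>y\<bar>" for y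
        by (simp add: abs_mult)
      ultimately have "\<bar>A r - 4 * c\<bar> = 2 / (pi * r\<^sup>2) * \<bar>?I - 2*pi*(u z + c * r\<^sup>2)\<bar>"
        by (simp only:)
      also have "\<dots> \<le> 2 / (pi * r\<^sup>2) * (k / 4 * r\<^sup>2 * pi)"
        by (rule mult_left_mono[OF b]) simp
      also have "\<dots> = k / 2" using r by (simp add: field_simps)
      finally show ?thesis using k by (simp add: dist_real_def)
    qed
    then show "\<forall>\<^sub>F r in at_right 0. dist (A r) (4 * c) < k"
      using d e by (auto simp: eventually_at_right_field intro!: exI[of _ "min d e"])
  qed
  then have "((\<lambda>r. ereal (A r)) \<longlongrightarrow> ereal (4 * c)) (at_right 0)" by simp
  then show ?thesis
    unfolding lower_laplace_def A_def by (intro lim_imp_Liminf) auto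
qed

text \<open>
  If \<open>v\<close> touches \<open>u\<close> from below at \<open>z\<close>, the circle means compare while the central values agree.
  All curvature estimates below, at maxima and along the glueing circle, rest on this.
\<close>

lemma lower_laplace_mono:
  assumes e: "e > 0" and cont: "continuous_on (ball z e) u" "continuous_on (ball z e) v"
    and le: "\<And>w. w \<in> ball z e \<Longrightarrow> v w \<le> u w" and eq: "v z = u z"
  shows "lower_laplace v z \<le> lower_laplace u z"
  unfolding lower_laplace_def
proof (rule Liminf_mono)
  have "ereal (4 / r\<^sup>2 * (1 / (2 * pi) * integral {0..2 * pi} (\<lambda>t. v (z + of_real r * cis t)) - v z))
     \<le> ereal (4 / r\<^sup>2 * (1 / (2 * pi) * integral {0..2 * pi} (\<lambda>t. u (z + of_real r * cis t)) - u z))"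
    if r: "0 < r" "r < e" for r
  proof -
    have "integral {0..2 * pi} (\<lambda>t. v (z + of_real r * cis t))
         \<le> integral {0..2 * pi} (\<lambda>t. u (z + of_real r * cis t))"
      by (intro integral_le integrable_on_circle[OF cont(1) r] integrable_on_circle[OF cont(2) r] le circle_in_ball[OF r])
    then show ?thesis
      using r unfolding eq ereal_less_eq by (intro mult_left_mono diff_right_mono) (auto simp: divide_right_mono)
  qed
  then show "\<forall>\<^sub>F r in at_right 0.
      ereal (4 / r\<^sup>2 * (1 / (2 * pi) * integral {0..2 * pi} (\<lambda>t. v (z + of_real r * cis t)) - v z))
     \<le> ereal (4 / r\<^sup>2 * (1 / (2 * pi) * integral {0..2 * pi} (\<lambda>t. u (z + of_real r * cis t)) - u z))"
    using e by (auto simp: eventually_at_right_field)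
qed

lemma lower_laplace_add_const:
  assumes e: "e > 0" and cont: "continuous_on (ball z e) u"
  shows "lower_laplace (\<lambda>w. u w + k) z = lower_laplace u z"
  unfolding lower_laplace_def
proof (rule Liminf_eq)
  have *: "1 / (2 * pi) * integral {0..2 * pi} (\<lambda>t. u (z + of_real r * cis t) + k) - (u z + k)
     = 1 / (2 * pi) * integral {0..2 * pi} (\<lambda>t. u (z + of_real r * cis t)) - u z"
    if r: "0 < r" "r < e" for r
    by (subst integral_add) (use integrable_on_circle[OF cont r] in \<open>auto simp: field_simps\<close>)
  then show "\<forall>\<^sub>F r in at_right 0.
      ereal (4 / r\<^sup>2 * (1 / (2 * pi) * integral {0..2 * pi} (\<lambda>t. u (z + of_real r * cis t) + k) - (u z + k)))
     = ereal (4 / r\<^sup>2 * (1 / (2 * pi) * integral {0..2 * pi} (\<lambda>t. u (z + of_real r * cis t)) - u z))"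
    unfolding eventually_at_right_field
  proof (intro exI conjI allI impI)
    show "0 < e" by (rule e)
  qed (simp only: *)
qed

text \<open>
  Peano form of the second order Taylor formula: the derivative of the remainder is \<open>o(t)\<close> by
  differentiability of \<open>f'\<close> at the single point \<open>x0\<close>, and the mean value theorem integrates this.
\<close>

lemma taylor2_little_o:
  fixes f f' :: "real \<Rightarrow> real"
  assumes d1: "\<forall>\<^sub>F x in nhds x0. (f has_real_derivative f' x) (at x)"
    and d2: "(f' has_real_derivative D) (at x0)" and e: "e > 0"
  shows "\<forall>\<^sub>F t in nhds 0. \<bar>f (x0 + t) - (f x0 + f' x0 * t + D / 2 * t\<^sup>2)\<bar> \<le> e * t\<^sup>2"
proof -
  obtain r where r: "r > 0" "\<And>x. \<bar>x - x0\<bar> < r \<Longrightarrow> (f has_real_derivative f' x) (at x)"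
    using d1 by (auto simp: eventually_nhds_metric dist_real_def)
  have "\<exists>s>0. \<forall>t. \<bar>t\<bar> < s \<longrightarrow> \<bar>f' (x0 + t) - f' x0 - D * t\<bar> \<le> e * \<bar>t\<bar>"
  proof -
    have "(\<lambda>t. (f' (x0 + t) - f' x0) / t) \<midarrow>0\<rightarrow> D" using d2 by (simp add: DERIV_def)
    then obtain s where s: "s > 0"
      "\<And>t. t \<noteq> 0 \<Longrightarrow> \<bar>t\<bar> < s \<Longrightarrow> \<bar>(f' (x0 + t) - f' x0) / t - D\<bar> < e"
      using e unfolding LIM_eq by (metis diff_zero real_norm_def)
    have "\<bar>f' (x0 + t) - f' x0 - D * t\<bar> \<le> e * \<bar>t\<bar>" if "\<bar>t\<bar> < s" for t
    proof (cases "t = 0")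
      case False
      have "\<bar>f' (x0 + t) - f' x0 - D * t\<bar> = \<bar>(f' (x0 + t) - f' x0) / t - D\<bar> * \<bar>t\<bar>"
        using False by (simp add: abs_mult[symmetric] field_simps)
      also have "\<dots> \<le> e * \<bar>t\<bar>" using s(2)[OF False that] by (intro mult_right_mono) auto
      finally show ?thesis .
    qed auto
    then show ?thesis using s(1) by blast
  qed
  then obtain s where s: "s > 0" "\<And>t. \<bar>t\<bar> < s \<Longrightarrow> \<bar>f' (x0 + t) - f' x0 - D * t\<bar> \<le> e * \<bar>t\<bar>"
    by blast
  have "\<bar>f (x0 + t) - (f x0 + f' x0 * t + D / 2 * t\<^sup>2)\<bar> \<le> e * t\<^sup>2" if t: "\<bar>t\<bar> < min r s" for t
  proof -
    define g where "g = (\<lambda>t. f (x0 + t) - (f x0 + f' x0 * t + D / 2 * t\<^sup>2))"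
    have "norm (g t - g 0) \<le> (e * \<bar>t\<bar>) * norm (t - 0)"
    proof (rule field_differentiable_bound[where S = "closed_segment 0 t" and f' = "\<lambda>t. f' (x0 + t) - f' x0 - D * t"])
      fix y assume y: "y \<in> closed_segment 0 t"
      then have y': "\<bar>y\<bar> \<le> \<bar>t\<bar>" by (auto simp: closed_segment_eq_real_ivl split: if_splits)
      have "(f has_real_derivative f' (x0 + y)) (at (x0 + y))" using r(2)[of "x0 + y"] y' t by simp
      then have "((\<lambda>y. f (x0 + y)) has_real_derivative f' (x0 + y)) (at y)"
        by (simp add: DERIV_at_within_shift_lemma DERIV_shift[symmetric] field_simps)
      then have "(g has_real_derivative f' (x0 + y) - f' x0 - D * y) (at y)"
        unfolding g_def by (auto intro!: derivative_eq_intros)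
      then show "(g has_field_derivative f' (x0 + y) - f' x0 - D * y) (at y within closed_segment 0 t)"
        by (rule has_field_derivative_at_within)
      show "norm (f' (x0 + y) - f' x0 - D * y) \<le> e * \<bar>t\<bar>"
        using s(2)[of y] y' t e by (smt (verit) mult_left_mono real_norm_def)
    qed auto
    then show ?thesis by (simp add: g_def power2_eq_square)
  qed
  then show ?thesis using r s
    by (auto simp: eventually_nhds_metric dist_real_def intro!: exI[of _ "min r s"])
qed

text \<open>
  The squared modulus is itself a quadratic polynomial, \<open>\<bar>z + h - p\<bar>\<^sup>2 = \<bar>z - p\<bar>\<^sup>2 + X h\<close> with
  \<open>X h = 2 Re (m h) + \<bar>h\<bar>\<^sup>2\<close> and \<open>m\<close> conjugate to \<open>z - p\<close>. Inserting this into the one-variable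
  Taylor formula and using \<open>2 (Re (m h))\<^sup>2 = Re (m\<^sup>2 h\<^sup>2) + \<bar>m h\<bar>\<^sup>2\<close> isolates the coefficient at \<open>\<bar>h\<bar>\<^sup>2\<close>.
\<close>

lemma circle_expansion_radial:
  fixes f f' :: "real \<Rightarrow> real"
  assumes d1: "\<forall>\<^sub>F x in nhds ((cmod (z - p))\<^sup>2). (f has_real_derivative f' x) (at x)"
    and d2: "(f' has_real_derivative D) (at ((cmod (z - p))\<^sup>2))"
  shows "circle_expansion (\<lambda>w. f ((cmod (w - p))\<^sup>2)) z (f' ((cmod (z - p))\<^sup>2) + D * (cmod (z - p))\<^sup>2)"
proof -
  define m where "m = cnj (z - p)"
  define x0 where "x0 = (cmod (z - p))\<^sup>2"
  define X where "X = (\<lambda>h. 2 * Re (m * h) + (cmod h)\<^sup>2)"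
  define K where "K = 2 * cmod m + 1"
  have K: "K \<ge> 1" by (simp add: K_def)
  have x: "(cmod (z + h - p))\<^sup>2 = x0 + X h" for h
    unfolding x0_def X_def m_def cmod_power2 by (simp add: power2_eq_square algebra_simps)
  have m: "(cmod m)\<^sup>2 = x0" by (simp add: m_def x0_def del: complex_cnj_diff)
  have X0: "(X \<longlongrightarrow> 0) (nhds 0)"
    unfolding X_def by (rule tendsto_eq_intros filterlim_ident refl | simp)+
  have Xb: "\<bar>X h\<bar> \<le> K * cmod h" if "cmod h \<le> 1" for h
  proof -
    have "\<bar>Re (m * h)\<bar> \<le> cmod m * cmod h" using abs_Re_le_cmod[of "m * h"] by (simp add: norm_mult)
    moreover have "(cmod h)\<^sup>2 \<le> cmod h" using that by (simp add: power2_eq_square mult_left_le)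
    moreover have "K * cmod h = 2 * (cmod m * cmod h) + cmod h"
      unfolding K_def by (simp add: algebra_simps)
    moreover have "0 \<le> (cmod h)\<^sup>2" by simp
    ultimately show ?thesis unfolding X_def abs_le_iff by linarith
  qed
  have Xsq: "\<bar>(X h)\<^sup>2 - (Re (2 * m\<^sup>2 * h\<^sup>2) + 2 * x0 * (cmod h)\<^sup>2)\<bar> \<le> 3 * K * cmod h ^ 3"
    if "cmod h \<le> 1" for h
  proof -
    have "2 * (Re (m * h))\<^sup>2 = Re (m\<^sup>2 * h\<^sup>2) + (cmod (m * h))\<^sup>2"
      unfolding cmod_power2 by (simp add: power2_eq_square algebra_simps)
    then have "(X h)\<^sup>2 - (Re (2 * m\<^sup>2 * h\<^sup>2) + 2 * x0 * (cmod h)\<^sup>2) = (4 * Re (m * h) + (cmod h)\<^sup>2) * (cmod h)\<^sup>2"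
      unfolding X_def m[symmetric] by (simp add: power2_eq_square algebra_simps norm_mult)
    also have "\<bar>\<dots>\<bar> \<le> (3 * K * cmod h) * (cmod h)\<^sup>2"
    proof -
      have "\<bar>Re (m * h)\<bar> \<le> cmod m * cmod h" using abs_Re_le_cmod[of "m * h"] by (simp add: norm_mult)
      moreover have "(cmod h)\<^sup>2 \<le> cmod h" using that by (simp add: power2_eq_square mult_left_le)
      moreover have "3 * K * cmod h = 6 * (cmod m * cmod h) + 3 * cmod h"
        unfolding K_def by (simp add: algebra_simps)
      moreover have "0 \<le> (cmod h)\<^sup>2" "0 \<le> cmod m * cmod h" by simp_all
      ultimately have "\<bar>4 * Re (m * h) + (cmod h)\<^sup>2\<bar> \<le> 3 * K * cmod h"
        unfolding abs_le_iff by linarith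
      then show ?thesis by (simp add: abs_mult mult_right_mono)
    qed
    finally show ?thesis by (simp add: power3_eq_cube power2_eq_square algebra_simps)
  qed
  show ?thesis
    unfolding circle_expansion_def x0_def[symmetric]
  proof (intro exI allI impI)
    fix e :: real assume e: "e > 0"
    have "\<forall>\<^sub>F t in nhds 0. \<bar>f (x0 + t) - (f x0 + f' x0 * t + D / 2 * t\<^sup>2)\<bar> \<le> (e / (2 * K\<^sup>2)) * t\<^sup>2"
      using taylor2_little_o[OF d1 d2, of "e / (2 * K\<^sup>2)"] e K by (simp add: x0_def)
    then have 1: "\<forall>\<^sub>F h in nhds 0. \<bar>f (x0 + X h) - (f x0 + f' x0 * X h + D / 2 * (X h)\<^sup>2)\<bar>
                  \<le> (e / (2 * K\<^sup>2)) * (X h)\<^sup>2"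
      using X0 by (auto simp: filterlim_iff)
    have 2: "\<forall>\<^sub>F h in nhds (0::complex). cmod h < min 1 (e / (3 * K * (\<bar>D\<bar> + 1)))"
      using e K by (intro order_tendstoD(2)[of _ "cmod 0"] tendsto_norm filterlim_ident) auto
    show "\<forall>\<^sub>F h in nhds 0. \<bar>f ((cmod (z + h - p))\<^sup>2) -
        (f x0 + Re (2 * f' x0 * m * h + D * m\<^sup>2 * h\<^sup>2) + (f' x0 + D * x0) * (cmod h)\<^sup>2)\<bar>
          \<le> e * (cmod h)\<^sup>2"
      using 1 2
    proof eventually_elim
      case (elim h)
      let ?R = "(X h)\<^sup>2 - (Re (2 * m\<^sup>2 * h\<^sup>2) + 2 * x0 * (cmod h)\<^sup>2)"
      have h1: "cmod h \<le> 1" and h2: "3 * K * (\<bar>D\<bar> + 1) * cmod h \<le> e"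
        using elim(2) K pos_le_divide_eq[of "3 * K * (\<bar>D\<bar> + 1)" "cmod h" e]
        by (simp_all add: mult.commute)
      have "(X h)\<^sup>2 \<le> (K * cmod h)\<^sup>2" using Xb[OF h1] K by (intro abs_le_square_iff[THEN iffD1]) auto
      then have "(e / (2 * K\<^sup>2)) * (X h)\<^sup>2 \<le> (e / (2 * K\<^sup>2)) * (K * cmod h)\<^sup>2"
        using e by (intro mult_left_mono) auto
      also have "\<dots> = e / 2 * (cmod h)\<^sup>2" using K by (simp add: power_mult_distrib)
      finally have A: "\<bar>f (x0 + X h) - (f x0 + f' x0 * X h + D / 2 * (X h)\<^sup>2)\<bar> \<le> e / 2 * (cmod h)\<^sup>2"
        using elim(1) by linarith
      have "\<bar>D / 2 * y\<bar> = \<bar>D\<bar> / 2 * \<bar>y\<bar>" for y by (simp add: abs_mult)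
      then have "\<bar>D / 2 * ?R\<bar> = \<bar>D\<bar> / 2 * \<bar>?R\<bar>" .
      also have "\<dots> \<le> (\<bar>D\<bar> + 1) / 2 * (3 * K * cmod h ^ 3)"
        using Xsq[OF h1] by (intro mult_mono) auto
      also have "\<dots> = (3 * K * (\<bar>D\<bar> + 1) * cmod h) / 2 * (cmod h)\<^sup>2"
        by (simp add: power2_eq_square power3_eq_cube)
      also have "\<dots> \<le> e / 2 * (cmod h)\<^sup>2"
        by (rule mult_right_mono[OF divide_right_mono[OF h2]]) simp_all
      finally have B: "\<bar>D / 2 * ?R\<bar> \<le> e / 2 * (cmod h)\<^sup>2" .
      have "f ((cmod (z + h - p))\<^sup>2) -
        (f x0 + Re (2 * f' x0 * m * h + D * m\<^sup>2 * h\<^sup>2) + (f' x0 + D * x0) * (cmod h)\<^sup>2)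
        = (f (x0 + X h) - (f x0 + f' x0 * X h + D / 2 * (X h)\<^sup>2)) + D / 2 * ?R"
        unfolding x by (simp add: X_def algebra_simps)
      then show ?case using A B by linarith
    qed
  qed
qed

text \<open>
  In the variable \<open>s = log \<bar>w - p\<bar>\<close>, which is harmonic, the Laplacian of \<open>f s\<close> is
  \<open>f'' s \<bar>\<nabla>s\<bar>\<^sup>2 = f'' s / \<bar>w - p\<bar>\<^sup>2\<close>; first derivatives drop out.
\<close>

lemma circle_expansion_log_radial:
  fixes f f' :: "real \<Rightarrow> real"
  assumes z: "z \<noteq> p"
    and d1: "\<forall>\<^sub>F x in nhds (ln (cmod (z - p))). (f has_real_derivative f' x) (at x)"
    and d2: "(f' has_real_derivative D) (at (ln (cmod (z - p))))"
  shows "circle_expansion (\<lambda>w. f (ln (cmod (w - p)))) z (D / (4 * (cmod (z - p))\<^sup>2))"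
proof -
  define x0 where "x0 = (cmod (z - p))\<^sup>2"
  define s0 where "s0 = ln (cmod (z - p))"
  have x0: "x0 > 0" using z by (simp add: x0_def)
  have s: "ln (cmod (w - p)) = ln ((cmod (w - p))\<^sup>2) / 2" for w
    by (cases "w = p") (auto simp: ln_realpow)
  have s0: "s0 = ln x0 / 2" unfolding s0_def x0_def by (rule s)
  have lim: "((\<lambda>x. ln x / 2) \<longlongrightarrow> s0) (nhds x0)"
    unfolding s0 using x0 by (intro tendsto_intros filterlim_ident) auto
  have 1: "\<forall>\<^sub>F x in nhds x0. (f has_real_derivative f' (ln x / 2)) (at (ln x / 2))"
    using d1 lim unfolding s0_def[symmetric] by (auto simp: filterlim_iff)
  have 2: "\<forall>\<^sub>F x in nhds x0. 0 < x" using x0 by (intro order_tendstoD(1)[OF filterlim_ident])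
  have "\<forall>\<^sub>F x in nhds x0. ((\<lambda>x. f (ln x / 2)) has_real_derivative f' (ln x / 2) / (2 * x)) (at x)"
    using 1 2
  proof eventually_elim
    case (elim x)
    have "((\<lambda>x. ln x / 2) has_real_derivative 1 / (2 * x)) (at x)"
      using elim(2) by (auto intro!: derivative_eq_intros)
    from DERIV_chain2[OF elim(1) this] show ?case by simp
  qed
  moreover have "((\<lambda>x. f' (ln x / 2) / (2 * x)) has_real_derivative
      (D / (4 * x0\<^sup>2) - f' s0 / (2 * x0\<^sup>2))) (at x0)"
  proof -
    have "((\<lambda>x. ln x / 2) has_real_derivative 1 / (2 * x0)) (at x0)"
      using x0 by (auto intro!: derivative_eq_intros)
    from DERIV_chain2[OF _ this, of f' D] d2
    have "((\<lambda>x. f' (ln x / 2)) has_real_derivative D * (1 / (2 * x0))) (at x0)"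
      by (simp add: s0_def[symmetric] s0)
    moreover have "((\<lambda>x. 2 * x) has_real_derivative 2) (at x0)"
      by (auto intro!: derivative_eq_intros)
    ultimately have "((\<lambda>x. f' (ln x / 2) / (2 * x)) has_real_derivative
        (D * (1 / (2 * x0)) * (2 * x0) - f' (ln x0 / 2) * 2) / (2 * x0 * (2 * x0))) (at x0)"
      using x0 by (intro DERIV_divide) auto
    then show ?thesis
      by (rule DERIV_cong) (use x0 in \<open>simp add: s0 power2_eq_square field_simps\<close>)
  qed
  ultimately have "circle_expansion (\<lambda>w. (\<lambda>x. f (ln x / 2)) ((cmod (w - p))\<^sup>2)) z
      (f' (ln x0 / 2) / (2 * x0) + (D / (4 * x0\<^sup>2) - f' s0 / (2 * x0\<^sup>2)) * x0)"
    unfolding x0_def by (rule circle_expansion_radial)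
  moreover have "f' (ln x0 / 2) / (2 * x0) + (D / (4 * x0\<^sup>2) - f' s0 / (2 * x0\<^sup>2)) * x0 = D / (4 * x0)"
    using x0 by (simp add: s0 field_simps power2_eq_square)
  ultimately show ?thesis unfolding s by (simp only: x0_def)
qed

section \<open>Curvature bounds under touching, and glueing\<close>

text \<open>
  In this form the curvature bound is the differential inequality \<open>\<Delta>u \<ge> exp (2u)\<close> for
  \<open>u = log \<mu>\<close>, free of extended real division.
\<close>

lemma curvature_le_minus_one_iff:
  assumes "\<mu> z > 0"
  shows "curvature \<mu> z \<le> -1 \<longleftrightarrow> ereal ((\<mu> z)\<^sup>2) \<le> lower_laplace (\<lambda>w. ln (\<mu> w)) z"
proof -
  have "(\<mu> z)\<^sup>2 > 0" using assms by simp
  then show ?thesis unfolding curvature_def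
    by (cases "lower_laplace (\<lambda>w. ln (\<mu> w)) z") (auto simp: one_ereal_def field_simps)
qed

lemma positive_ball:
  fixes \<mu> :: "complex \<Rightarrow> real"
  assumes "open U" "continuous_on U \<mu>" "z \<in> U" "\<mu> z > 0"
  obtains e where "e > 0" "ball z e \<subseteq> U" "\<And>w. w \<in> ball z e \<Longrightarrow> \<mu> w > 0"
proof -
  have "open (U \<inter> \<mu> -` {0<..})"
    by (rule continuous_open_preimage[OF assms(2,1)]) auto
  then obtain e where "e > 0" "ball z e \<subseteq> U \<inter> \<mu> -` {0<..}"
    using assms(3,4) by (metis IntI greaterThan_iff open_contains_ball vimageI)
  then show ?thesis by (intro that[of e]) auto
qed

lemma curvature_le_if_supported:
  assumes U: "open U" "z \<in> U" and cont: "continuous_on U \<sigma>" "continuous_on U \<nu>"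
    and le: "\<And>w. w \<in> U \<Longrightarrow> \<nu> w \<le> \<sigma> w" and eq: "\<nu> z = \<sigma> z" and pos: "\<nu> z > 0"
    and curv: "curvature \<nu> z \<le> -1"
  shows "curvature \<sigma> z \<le> -1"
proof -
  obtain e where e: "e > 0" "ball z e \<subseteq> U" "\<And>w. w \<in> ball z e \<Longrightarrow> \<nu> w > 0"
    using positive_ball[OF U(1) cont(2) U(2) pos] by blast
  have sp: "\<sigma> w > 0" if "w \<in> ball z e" for w using e(3)[OF that] le[of w] e(2) that by force
  have "lower_laplace (\<lambda>w. ln (\<nu> w)) z \<le> lower_laplace (\<lambda>w. ln (\<sigma> w)) z"
  proof (rule lower_laplace_mono[OF e(1)])
    show "continuous_on (ball z e) (\<lambda>w. ln (\<sigma> w))" "continuous_on (ball z e) (\<lambda>w. ln (\<nu> w))"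
      using less_imp_neq[OF e(3)] less_imp_neq[OF sp] continuous_on_subset[OF cont(1) e(2)]
        continuous_on_subset[OF cont(2) e(2)]
      by (intro continuous_on_ln; force)+
    show "ln (\<nu> w) \<le> ln (\<sigma> w)" if "w \<in> ball z e" for w
      using e(3)[OF that] sp[OF that] le[of w] e(2) that by (auto simp: ln_le_cancel_iff)
  qed (simp add: eq)
  then show ?thesis
    using curv curvature_le_minus_one_iff[of \<nu> z] curvature_le_minus_one_iff[of \<sigma> z] pos eq
      order_trans by fastforce
qed

lemma curvature_exp_le:
  assumes "e > 0" "continuous_on (ball z e) v" "circle_expansion v z c" "(exp (v z))\<^sup>2 \<le> 4 * c"
  shows "curvature (\<lambda>w. exp (v w)) z \<le> -1"
  using assms by (subst curvature_le_minus_one_iff) (auto simp: lower_laplace_eq)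

text \<open>
  The local step of the Ahlfors principle: at a maximum of \<open>log \<mu> - v\<close> the curvature bound for \<open>\<mu>\<close>
  forces \<open>\<mu>\<^sup>2 \<le> \<Delta>(log \<mu>) \<le> \<Delta>v\<close>, and \<open>\<Delta>v = 4 c\<close>.
\<close>

lemma density_bound_if_touching_above:
  assumes U: "open U" "z \<in> U" and cont: "continuous_on U \<mu>" "continuous_on U v"
    and pos: "\<mu> z > 0" and curv: "curvature \<mu> z \<le> -1"
    and le: "\<And>w. w \<in> U \<Longrightarrow> \<mu> w > 0 \<Longrightarrow> ln (\<mu> w) - v w \<le> ln (\<mu> z) - v z"
    and ex: "circle_expansion v z c"
  shows "(\<mu> z)\<^sup>2 \<le> 4 * c"
proof -
  obtain e where e: "e > 0" "ball z e \<subseteq> U" "\<And>w. w \<in> ball z e \<Longrightarrow> \<mu> w > 0"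
    using positive_ball[OF U(1) cont(1) U(2) pos] by blast
  define k where "k = ln (\<mu> z) - v z"
  have cv: "continuous_on (ball z e) v" by (rule continuous_on_subset[OF cont(2) e(2)])
  have "ereal ((\<mu> z)\<^sup>2) \<le> lower_laplace (\<lambda>w. ln (\<mu> w)) z"
    using curv pos by (simp add: curvature_le_minus_one_iff)
  also have "\<dots> \<le> lower_laplace (\<lambda>w. v w + k) z"
  proof (rule lower_laplace_mono[OF e(1)])
    show "continuous_on (ball z e) (\<lambda>w. ln (\<mu> w))"
      using less_imp_neq[OF e(3)] continuous_on_subset[OF cont(1) e(2)]
      by (intro continuous_on_ln) force+
    show "continuous_on (ball z e) (\<lambda>w. v w + k)" by (intro continuous_intros cv)
    show "ln (\<mu> w) \<le> v w + k" if "w \<in> ball z e" for w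
      using le[of w] e(2) e(3)[OF that] that by (auto simp: k_def)
  qed (simp add: k_def)
  also have "\<dots> = ereal (4 * c)"
    using lower_laplace_add_const[OF e(1) cv] lower_laplace_eq[OF e(1) cv ex] by simp
  finally show ?thesis by simp
qed

text \<open>
  At a point where the new density equals \<open>\<mu>\<close> it is supported from below by \<open>\<mu>\<close>; this includes
  the frontier of \<open>D\<close>, where \<open>\<nu> \<le> \<mu>\<close>. At any other point, which then lies in the interior of \<open>D\<close>, it
  is supported by \<open>\<nu>\<close>. The boundary inequality also makes the two pieces fit continuously.
\<close>

lemma SK_metric_glue:
  assumes G: "open G" and D: "closed D" and sk: "SK_metric G \<mu>"
    and cont: "continuous_on (G \<inter> D) \<nu>"
    and bd: "\<And>w. w \<in> G \<Longrightarrow> w \<in> frontier D \<Longrightarrow> \<nu> w \<le> \<mu> w"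
    and curv: "\<And>w. w \<in> G \<Longrightarrow> w \<in> interior D \<Longrightarrow> \<nu> w > 0 \<Longrightarrow> curvature \<nu> w \<le> -1"
  shows "SK_metric G (\<lambda>w. if w \<in> D then max (\<mu> w) (\<nu> w) else \<mu> w)" (is "SK_metric G ?\<sigma>")
proof -
  have c: "continuous_on G \<mu>" and nn: "\<And>w. w \<in> G \<Longrightarrow> \<mu> w \<ge> 0" and nz: "\<exists>z\<in>G. \<mu> z \<noteq> 0"
    and cu: "\<And>w. w \<in> G \<Longrightarrow> \<mu> w > 0 \<Longrightarrow> curvature \<mu> w \<le> -1"
    using sk by (auto simp: SK_metric_def conformal_pseudo_metric_def)
  have U: "(G \<inter> D) \<union> (G - interior D) = G" using interior_subset by blast
  have bd': "?\<sigma> w = \<mu> w" if "w \<in> G" "w \<notin> interior D" for w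
    using bd[of w] that D by (auto simp: frontier_def)
  have sc: "continuous_on G ?\<sigma>"
  proof -
    have "continuous_on ((G \<inter> D) \<union> (G - interior D)) ?\<sigma>"
    proof (rule continuous_on_cases_local)
      show "closedin (top_of_set (G \<inter> D \<union> (G - interior D))) (G \<inter> D)"
        unfolding U using D by (auto simp: closedin_closed)
      show "closedin (top_of_set (G \<inter> D \<union> (G - interior D))) (G - interior D)"
        unfolding U by (auto simp: closedin_closed intro!: exI[of _ "- interior D"])
      show "continuous_on (G \<inter> D) (\<lambda>w. max (\<mu> w) (\<nu> w))"
        by (intro continuous_on_max cont continuous_on_subset[OF c]) auto
      show "continuous_on (G - interior D) \<mu>" by (rule continuous_on_subset[OF c]) auto
      fix w assume "w \<in> G \<inter> D \<and> w \<notin> D \<or> w \<in> G - interior D \<and> w \<in> D"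
      then show "max (\<mu> w) (\<nu> w) = \<mu> w" using bd'[of w] by auto
    qed
    then show ?thesis by (simp only: U)
  qed
  have ge: "\<mu> w \<le> ?\<sigma> w" for w by auto
  have "curvature ?\<sigma> z \<le> -1" if z: "z \<in> G" "?\<sigma> z > 0" for z
  proof (cases "\<mu> z = ?\<sigma> z")
    case True
    with z(2) have pos: "\<mu> z > 0" by simp
    show ?thesis
      by (rule curvature_le_if_supported[OF G z(1) sc c ge True pos cu[OF z(1) pos]])
  next
    case False
    then have z': "z \<in> interior D" using bd'[OF z(1)] by fastforce
    then have zD: "z \<in> D" using interior_subset by blast
    have eq: "\<nu> z = ?\<sigma> z" using False zD by (auto simp: max_def split: if_splits)
    have pos: "\<nu> z > 0" using z(2) unfolding eq[symmetric] .
    have o: "open (G \<inter> interior D)" "z \<in> G \<inter> interior D" using G z z' by auto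
    have sub: "G \<inter> interior D \<subseteq> G \<inter> D" using interior_subset by blast
    show ?thesis
    proof (rule curvature_le_if_supported[where \<sigma> = ?\<sigma> and \<nu> = \<nu>, OF o _ _ _ eq pos curv[OF z(1) z' pos]])
      show "continuous_on (G \<inter> interior D) ?\<sigma>" by (rule continuous_on_subset[OF sc]) auto
      show "continuous_on (G \<inter> interior D) \<nu>" by (rule continuous_on_subset[OF cont sub])
      show "\<nu> w \<le> ?\<sigma> w" if "w \<in> G \<inter> interior D" for w
        using that sub by auto
    qed
  qed
  moreover have "\<exists>z\<in>G. ?\<sigma> z \<noteq> 0"
  proof -
    obtain z where z: "z \<in> G" "\<mu> z \<noteq> 0" using nz by blast
    then have "0 < ?\<sigma> z" using nn[of z] ge[of z] by linarith
    then show ?thesis using z(1) by (intro bexI[of _ z]) auto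
  qed
  ultimately show ?thesis
    unfolding SK_metric_def conformal_pseudo_metric_def
    using sc nn ge order_trans by blast
qed

section \<open>The comparison with annuli\<close>

text \<open>
  Up to the constant \<open>log (pi / L)\<close>, the function is the logarithm of the hyperbolic density of the
  annulus \<open>M - L < log \<bar>w - p\<bar> < M\<close>. That density is pulled back by the logarithm from the
  density \<open>(pi / L) / sin (pi x / L)\<close> of the strip \<open>0 < x < L\<close>.
\<close>

lemma annulus_log_density_expansion:
  fixes p z :: complex and M L :: real
  assumes L: "L > 0" and z: "z \<noteq> p" and s: "0 < M - ln (cmod (z - p))" "M - ln (cmod (z - p)) < L"
  shows "circle_expansion (\<lambda>w. - ln (cmod (w - p)) - ln (sin (pi * (M - ln (cmod (w - p))) / L))) z
     ((pi / L / sin (pi * (M - ln (cmod (z - p))) / L))\<^sup>2 / (4 * (cmod (z - p))\<^sup>2))"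
proof -
  let ?s0 = "ln (cmod (z - p))"
  let ?f = "\<lambda>s. - s - ln (sin (pi * (M - s) / L))"
  let ?f' = "\<lambda>s. - 1 + pi / L * (cos (pi * (M - s) / L) / sin (pi * (M - s) / L))"
  have sin_pos: "sin (pi * (M - s) / L) > 0" if "0 < M - s" "M - s < L" for s
    using that L by (intro sin_gt_zero) (auto simp: pos_divide_less_eq)
  have "circle_expansion (\<lambda>w. ?f (ln (cmod (w - p)))) z
     ((pi / L / sin (pi * (M - ?s0) / L))\<^sup>2 / (4 * (cmod (z - p))\<^sup>2))"
  proof (rule circle_expansion_log_radial[OF z])
    have "open {M - L<..<M}" "?s0 \<in> {M - L<..<M}" using s by auto
    then have "\<forall>\<^sub>F x in nhds ?s0. x \<in> {M - L<..<M}" by (rule eventually_nhds_in_open)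
    then show "\<forall>\<^sub>F x in nhds ?s0. (?f has_real_derivative ?f' x) (at x)"
    proof eventually_elim
      case (elim x)
      then have "sin (pi * (M - x) / L) > 0" by (intro sin_pos) auto
      then show ?case by (auto intro!: derivative_eq_intros simp: field_simps)
    qed
    let ?S = "sin (pi * (M - ?s0) / L)" and ?C = "cos (pi * (M - ?s0) / L)"
    have S: "?S > 0" using s by (rule sin_pos)
    have "(?f' has_real_derivative
        pi / L * (((- ?S * (- pi / L)) * ?S - ?C * (?C * (- pi / L))) / (?S * ?S))) (at ?s0)"
      using S L by (auto intro!: derivative_eq_intros simp: field_simps)
    then show "(?f' has_real_derivative (pi / L / ?S)\<^sup>2) (at ?s0)"
    proof (rule DERIV_cong)
      have "(- s * (- pi / L)) * s - c * (c * (- pi / L)) = pi / L * (s\<^sup>2 + c\<^sup>2)" for c s :: real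
        by (simp add: power2_eq_square algebra_simps add_divide_distrib)
      then have "(- ?S * (- pi / L)) * ?S - ?C * (?C * (- pi / L)) = pi / L"
        by (simp only: sin_cos_squared_add mult_1_right)
      then show "pi / L * (((- ?S * (- pi / L)) * ?S - ?C * (?C * (- pi / L))) / (?S * ?S)) = (pi / L / ?S)\<^sup>2"
        by (simp add: power2_eq_square)
    qed
  qed
  then show ?thesis .
qed

text \<open>
  Ahlfors principle. The left-hand side vanishes on both boundary circles, where the sine does, so a
  value above \<open>pi / L\<close> yields an interior maximum, and the touching lemma applies to it.
\<close>

lemma SK_metric_le_annulus:
  fixes p z :: complex
  assumes sk: "SK_metric G \<mu>" and R: "R > 0" and L: "L > 0"
    and sub: "{w. R * exp (- L) \<le> cmod (w - p) \<and> cmod (w - p) \<le> R} \<subseteq> G"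
    and z: "R * exp (- L) \<le> cmod (z - p)" "cmod (z - p) \<le> R"
  shows "\<mu> z * cmod (z - p) * sin (pi * (ln R - ln (cmod (z - p))) / L) \<le> pi / L"
proof (rule ccontr)
  define K where "K = {w. R * exp (- L) \<le> cmod (w - p) \<and> cmod (w - p) \<le> R}"
  define U where "U = {w. R * exp (- L) < cmod (w - p) \<and> cmod (w - p) < R}"
  define S where "S = (\<lambda>w. sin (pi * (ln R - ln (cmod (w - p))) / L))"
  \<comment> \<open>the quotient of \<open>\<mu>\<close> by the annulus density, times \<open>pi / L\<close>\<close>
  define Q where "Q = (\<lambda>w. \<mu> w * cmod (w - p) * S w)"
  assume "\<not> \<mu> z * cmod (z - p) * sin (pi * (ln R - ln (cmod (z - p))) / L) \<le> pi / L"
  then have Qz: "Q z > pi / L" by (simp add: Q_def S_def)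
  have c: "continuous_on G \<mu>" and nn: "\<And>w. w \<in> G \<Longrightarrow> \<mu> w \<ge> 0"
    and cu: "\<And>w. w \<in> G \<Longrightarrow> \<mu> w > 0 \<Longrightarrow> curvature \<mu> w \<le> -1"
    using sk by (auto simp: SK_metric_def conformal_pseudo_metric_def)
  have m: "0 < R * exp (- L)" using R by simp
  have KG: "K \<subseteq> G" using sub by (simp add: K_def)
  have UK: "U \<subseteq> K" by (auto simp: K_def U_def)
  have Kp: "w \<noteq> p" if "w \<in> K" for w using that m by (auto simp: K_def)
  have "closed K" unfolding K_def
    by (intro closed_Collect_conj closed_Collect_le continuous_intros)
  moreover have "bounded K" by (rule bounded_subset[OF bounded_cball[of p R]])
    (auto simp: K_def dist_norm norm_minus_commute)
  ultimately have cK: "compact K" by (simp add: compact_eq_bounded_closed)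
  have "continuous_on K Q"
    unfolding Q_def S_def using Kp L
    by (intro continuous_intros continuous_on_subset[OF c KG]) auto
  moreover have "z \<in> K" using z by (simp add: K_def)
  ultimately obtain w0 where w0: "w0 \<in> K" and mx: "\<And>w. w \<in> K \<Longrightarrow> Q w \<le> Q w0"
    using continuous_attains_sup[OF cK, of Q] by blast
  have Qw0: "Q w0 > pi / L" using Qz mx[OF \<open>z \<in> K\<close>] by linarith
  have Q0: "Q w0 > 0" using Qw0 L by (meson divide_pos_pos less_trans pi_gt_zero)
  have "cmod (w0 - p) \<noteq> R" using Q0 by (auto simp: Q_def S_def)
  moreover have "cmod (w0 - p) \<noteq> R * exp (- L)"
    using Q0 R L by (auto simp: Q_def S_def ln_mult)
  ultimately have w0U: "w0 \<in> U" using w0 by (auto simp: K_def U_def)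
  have oU: "open U" unfolding U_def
    by (intro open_Collect_conj open_Collect_less continuous_intros)
  have range: "0 < ln R - ln (cmod (w - p))" "ln R - ln (cmod (w - p)) < L" if "w \<in> U" for w
  proof -
    have "0 < cmod (w - p)" using that m by (auto simp: U_def)
    moreover from this have "ln (cmod (w - p)) < ln R" using that R by (simp add: U_def)
    moreover have "ln (R * exp (- L)) < ln (cmod (w - p))"
      using ln_less_cancel_iff[OF m \<open>0 < cmod (w - p)\<close>] that by (simp add: U_def)
    ultimately show "0 < ln R - ln (cmod (w - p))" "ln R - ln (cmod (w - p)) < L"
      using R by (auto simp: ln_mult)
  qed
  have Spos: "S w > 0" if "w \<in> U" for w
    using range[OF that] L unfolding S_def by (intro sin_gt_zero) (auto simp: pos_divide_less_eq)
  have apos: "cmod (w - p) > 0" if "w \<in> U" for w using that m by (auto simp: U_def)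
  \<comment> \<open>logarithm of the annulus density without its constant factor, so that \<open>log Q = log \<mu> - v\<close>\<close>
  define v where "v = (\<lambda>w. - ln (cmod (w - p)) - ln (S w))"
  have lnQ: "ln (Q w) = ln (\<mu> w) - v w" if "w \<in> U" "\<mu> w > 0" for w
    using Spos[OF that(1)] apos[OF that(1)] that(2) by (simp add: Q_def v_def ln_mult)
  have mpos: "\<mu> w0 > 0" using Q0 Spos[OF w0U] apos[OF w0U] nn[of w0] KG w0
    by (auto simp: Q_def zero_less_mult_iff)
  have "(\<mu> w0)\<^sup>2 \<le> 4 * ((pi / L / S w0)\<^sup>2 / (4 * (cmod (w0 - p))\<^sup>2))"
  proof (rule density_bound_if_touching_above[OF oU w0U])
    show "continuous_on U \<mu>" using continuous_on_subset[OF c] UK KG by blast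
    show "continuous_on U v" unfolding v_def S_def
      using apos Spos by (intro continuous_intros) (auto simp: S_def, force+)
    show "\<mu> w0 > 0" by fact
    show "curvature \<mu> w0 \<le> -1" using cu[OF _ mpos] w0 KG by blast
    show "ln (\<mu> w) - v w \<le> ln (\<mu> w0) - v w0" if "w \<in> U" "\<mu> w > 0" for w
    proof -
      have "Q w \<le> Q w0" using mx UK that by blast
      moreover have "Q w > 0" using that Spos[OF that(1)] apos[OF that(1)] by (simp add: Q_def)
      ultimately have "ln (Q w) \<le> ln (Q w0)" by simp
      then show ?thesis using lnQ[OF that] lnQ[OF w0U mpos] by simp
    qed
    show "circle_expansion v w0 ((pi / L / S w0)\<^sup>2 / (4 * (cmod (w0 - p))\<^sup>2))"
      unfolding v_def S_def
      by (rule annulus_log_density_expansion[OF L _ range[OF w0U]]) (use apos[OF w0U] in auto)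
  qed
  also have "\<dots> = (pi / L / (S w0 * cmod (w0 - p)))\<^sup>2"
    by (simp add: power_divide power_mult_distrib)
  finally have "\<mu> w0 \<le> pi / L / (S w0 * cmod (w0 - p))"
    using Spos[OF w0U] apos[OF w0U] L by (intro power2_le_imp_le[of "\<mu> w0"]) auto
  then have "Q w0 \<le> pi / L"
    using pos_le_divide_eq[of "S w0 * cmod (w0 - p)"] Spos[OF w0U] apos[OF w0U]
    by (simp only: Q_def mult_ac mult_pos_pos)
  then show False using Qw0 by simp
qed

lemma sin_small_angle_limit: "((\<lambda>L. L / pi * sin (pi * y / L)) \<longlongrightarrow> y) at_top"
  by real_asymp

text \<open>
  As the inner radius shrinks to 0, that is for \<open>L\<close> tending to infinity, the annulus densities
  decrease to the density of the punctured disc.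
\<close>

lemma SK_metric_le_punctured_disc:
  fixes p z :: complex
  assumes sk: "SK_metric G \<mu>" and R: "R > 0" and sub: "cball p R - {p} \<subseteq> G"
    and z: "z \<noteq> p" "cmod (z - p) \<le> R"
  shows "\<mu> z * cmod (z - p) * ln (R / cmod (z - p)) \<le> 1"
proof -
  define a where "a = cmod (z - p)"
  have a: "a > 0" "a \<le> R" using z by (auto simp: a_def)
  have "\<mu> z * a * (L / pi * sin (pi * (ln R - ln a) / L)) \<le> 1" if L: "L > 0" "L \<ge> ln R - ln a" for L
  proof -
    have "exp (- L) \<le> exp (ln a - ln R)" using L by simp
    then have "R * exp (- L) \<le> a" using a R by (simp add: exp_diff field_simps)
    moreover have "{w. R * exp (- L) \<le> cmod (w - p) \<and> cmod (w - p) \<le> R} \<subseteq> G"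
    proof -
      have "0 < R * exp (- L)" using R by simp
      then have "{w. R * exp (- L) \<le> cmod (w - p) \<and> cmod (w - p) \<le> R} \<subseteq> cball p R - {p}"
        by (auto simp: dist_norm norm_minus_commute)
      then show ?thesis using sub by blast
    qed
    ultimately have "\<mu> z * a * sin (pi * (ln R - ln a) / L) \<le> pi / L"
      using SK_metric_le_annulus[OF sk R L(1)] a unfolding a_def by blast
    then have "\<mu> z * a * sin (pi * (ln R - ln a) / L) * (L / pi) \<le> pi / L * (L / pi)"
      using L by (intro mult_right_mono) auto
    then show ?thesis using L by (simp add: mult_ac)
  qed
  note le = this
  have "\<forall>\<^sub>F L in at_top. \<mu> z * a * (L / pi * sin (pi * (ln R - ln a) / L)) \<le> 1"
    using eventually_gt_at_top[of 0] eventually_ge_at_top[of "ln R - ln a"]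
    by eventually_elim (rule le)
  then have "\<mu> z * a * (ln R - ln a) \<le> 1"
    by (intro tendsto_upperbound[OF tendsto_mult_left[OF sin_small_angle_limit]]) auto
  then show ?thesis using a R by (simp add: a_def ln_div)
qed

text \<open>
  A point at distance \<open>a\<close> from \<open>p\<close> lies on the middle circle of the annulus with radii \<open>a e\<^sup>-\<^sup>N\<close>
  and \<open>a e\<^sup>N\<close>, whose density there is \<open>pi / (2 N a)\<close>. It tends to 0, so the metric vanishes, and by
  continuity it does so at \<open>p\<close> too.
\<close>

lemma no_SK_metric_punctured_plane:
  assumes sk: "SK_metric G \<mu>" shows "\<not> - {p} \<subseteq> G"
proof
  assume sub: "- {p} \<subseteq> G"
  have c: "continuous_on G \<mu>" and nn: "\<And>w. w \<in> G \<Longrightarrow> \<mu> w \<ge> 0"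
    and nz: "\<exists>z\<in>G. \<mu> z \<noteq> 0"
    using sk by (auto simp: SK_metric_def conformal_pseudo_metric_def)
  have z0: "\<mu> z = 0" if z: "z \<noteq> p" for z
  proof -
    define a where "a = cmod (z - p)"
    have a: "a > 0" using z by (simp add: a_def)
    have "\<mu> z * a \<le> pi / (2 * N)" if N: "N > 0" for N :: real
    proof -
      have "a * exp N * exp (- (2 * N)) = a * exp (- N)"
        by (simp add: exp_add[symmetric] mult.assoc)
      moreover have "a * exp (- N) \<le> a * 1" "a * 1 \<le> a * exp N"
        using a N by (intro mult_left_mono; simp)+
      moreover have "{w. a * exp N * exp (- (2 * N)) \<le> cmod (w - p) \<and> cmod (w - p) \<le> a * exp N} \<subseteq> G"
      proof -
        have "0 < a * exp N * exp (- (2 * N))" using a by simp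
        then show ?thesis using sub by force
      qed
      ultimately have "\<mu> z * cmod (z - p) * sin (pi * (ln (a * exp N) - ln (cmod (z - p))) / (2 * N)) \<le> pi / (2 * N)"
        using a N by (intro SK_metric_le_annulus[OF sk]) (auto simp: a_def)
      moreover have "pi * (ln (a * exp N) - ln a) / (2 * N) = pi / 2"
        using a N by (simp add: ln_mult)
      ultimately show ?thesis unfolding a_def by (metis mult.right_neutral sin_pi_half)
    qed
    note le = this
    have "\<forall>\<^sub>F N in at_top. \<mu> z * a \<le> pi / (2 * N)"
      using eventually_gt_at_top[of 0] by eventually_elim (rule le)
    moreover have "((\<lambda>N::real. pi / (2 * N)) \<longlongrightarrow> 0) at_top" by real_asymp
    ultimately have "\<mu> z * a \<le> 0" by (intro tendsto_lowerbound) auto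
    then have "\<mu> z \<le> 0" using a by (simp add: mult_le_0_iff)
    then show ?thesis using nn[of z] sub z by force
  qed
  then have pG: "p \<in> G" and "\<mu> p \<noteq> 0" using nz by metis+
  have UG: "G = UNIV" using sub pG by auto
  have "isCont \<mu> p" using c UG by (simp add: continuous_on_eq_continuous_at)
  then have "\<mu> \<midarrow>p\<rightarrow> \<mu> p" by (simp add: isCont_def)
  moreover have "\<mu> \<midarrow>p\<rightarrow> 0"
    by (rule tendsto_eventually) (use z0 in \<open>auto simp: eventually_at_filter\<close>)
  ultimately show False using \<open>\<mu> p \<noteq> 0\<close> LIM_unique by blast
qed

section \<open>Two explicit densities\<close>

text \<open>
  The density \<open>1 / (\<bar>w - p\<bar> (M - log \<bar>w - p\<bar>))\<close> is the hyperbolic density of the disc of radius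
  \<open>e\<^sup>M\<close> punctured at its centre \<open>p\<close>; its curvature is exactly \<open>-1\<close>.
\<close>

lemma cusp_curvature:
  fixes p z :: complex
  assumes z: "z \<noteq> p" and s: "ln (cmod (z - p)) < M"
  shows "curvature (\<lambda>w. exp (- ln (cmod (w - p)) - ln (M - ln (cmod (w - p))))) z \<le> -1"
proof -
  let ?s0 = "ln (cmod (z - p))"
  let ?v = "\<lambda>w. - ln (cmod (w - p)) - ln (M - ln (cmod (w - p)))"
  define U where "U = {w. 0 < cmod (w - p) \<and> cmod (w - p) < exp M}"
  have "open U" unfolding U_def
    by (intro open_Collect_conj open_Collect_less continuous_intros)
  moreover have sM: "ln (cmod (w - p)) < M \<longleftrightarrow> w \<in> U" if "w \<noteq> p" for w
    using that ln_less_cancel_iff[of "cmod (w - p)" "exp M"] by (simp add: U_def)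
  then have "z \<in> U" using z s by blast
  ultimately obtain e where e: "e > 0" "ball z e \<subseteq> U" by (metis open_contains_ball)
  have Up: "w \<noteq> p" if "w \<in> U" for w using that by (auto simp: U_def)
  have "continuous_on U ?v"
    using sM Up by (intro continuous_intros) (force)+
  then have cont: "continuous_on (ball z e) ?v" using e(2) by (rule continuous_on_subset)
  have ex: "circle_expansion ?v z ((1 / (M - ?s0)\<^sup>2) / (4 * (cmod (z - p))\<^sup>2))"
  proof (rule circle_expansion_log_radial[OF z, where f = "\<lambda>s. - s - ln (M - s)"
        and f' = "\<lambda>s. - 1 + 1 / (M - s)"])
    have "open {..<M}" "?s0 \<in> {..<M}" using s by auto
    then have "\<forall>\<^sub>F x in nhds ?s0. x \<in> {..<M}" by (rule eventually_nhds_in_open)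
    then show "\<forall>\<^sub>F x in nhds ?s0. ((\<lambda>s. - s - ln (M - s)) has_real_derivative - 1 + 1 / (M - x)) (at x)"
      by eventually_elim (auto intro!: derivative_eq_intros simp: field_simps)
    show "((\<lambda>s. - 1 + 1 / (M - s)) has_real_derivative 1 / (M - ?s0)\<^sup>2) (at ?s0)"
      using s by (auto intro!: derivative_eq_intros simp: power2_eq_square)
  qed
  show ?thesis
  proof (rule curvature_exp_le[OF e(1) cont ex])
    have "exp (?v z) = 1 / (cmod (z - p) * (M - ?s0))"
      using z s by (simp add: exp_diff exp_minus field_simps)
    then show "(exp (?v z))\<^sup>2 \<le> 4 * ((1 / (M - ?s0)\<^sup>2) / (4 * (cmod (z - p))\<^sup>2))"
      by (simp add: power_divide power_mult_distrib mult.commute)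
  qed
qed

text \<open>
  The curvature inequality of the next lemma, in the variables \<open>A = \<bar>w - p\<bar>\<^bsup>1/3\<^esup>\<close> and
  \<open>B = \<bar>w - q\<bar>\<^bsup>1/3\<^esup>\<close>. By symmetry let \<open>A \<le> B\<close>. The first summand on the right then suffices,
  since \<open>(1 + A)\<^sup>3 (1 + B) \<le> (1 + B)\<^sup>4\<close> and, \<open>B\<close> being bounded below by \<open>\<kappa>\<close>, this is at
  most a constant times \<open>B\<^sup>5\<close>.
\<close>

lemma twice_punctured_inequality:
  fixes A B \<kappa> :: real
  assumes "\<kappa> > 0" "A > 0" "B > 0" "\<kappa> \<le> A \<or> \<kappa> \<le> B"
  shows "\<kappa> / (18 * (1 + 1 / \<kappa>) ^ 4) * (((1 + A) / A ^ 5) * ((1 + B) / B ^ 5))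
     \<le> (1 / (A ^ 5 * (1 + A)\<^sup>2) + 1 / (B ^ 5 * (1 + B)\<^sup>2)) / 18"
proof -
  define E where "E = \<kappa> / (1 + 1 / \<kappa>) ^ 4"
  have k1: "1 + 1 / \<kappa> > 0" using assms(1) by (simp add: add_pos_pos)
  have E: "E > 0" using assms(1) k1 by (simp add: E_def)
  have key: "E * (((1 + A) / A ^ 5) * ((1 + B) / B ^ 5)) \<le> 1 / (A ^ 5 * (1 + A)\<^sup>2)"
    if "0 < A" "A \<le> B" "\<kappa> \<le> B" for A B
  proof -
    have B: "B > 0" using that by linarith
    have "1 + B \<le> (1 + 1 / \<kappa>) * B" using that(3) assms(1) by (simp add: field_simps)
    then have "(1 + B) ^ 4 \<le> ((1 + 1 / \<kappa>) * B) ^ 4" using B by (intro power_mono) auto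
    then have "E * (1 + B) ^ 4 \<le> E * ((1 + 1 / \<kappa>) * B) ^ 4" using E by (intro mult_left_mono) auto
    also have "\<dots> = \<kappa> * B ^ 4" using k1 by (simp add: E_def power_mult_distrib)
    also have "\<dots> \<le> B * B ^ 4" using that(3) B by (intro mult_right_mono) auto
    finally have 1: "E * (1 + B) ^ 4 \<le> B ^ 5" by (simp add: power_Suc[symmetric] del: power_Suc)
    have "(1 + A) ^ 3 * (1 + B) \<le> (1 + B) ^ 3 * (1 + B)"
      using that B by (intro mult_right_mono power_mono) auto
    also have "\<dots> = (1 + B) ^ 4" by (simp add: power_Suc2[symmetric] del: power_Suc2 power_Suc)
    finally have "E * ((1 + A) ^ 3 * (1 + B)) \<le> E * (1 + B) ^ 4" using E by (intro mult_left_mono) auto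
    then have 2: "E * ((1 + A) ^ 3 * (1 + B)) \<le> B ^ 5" using 1 by linarith
    have "E * (((1 + A) / A ^ 5) * ((1 + B) / B ^ 5))
        = (E * ((1 + A) ^ 3 * (1 + B)) / B ^ 5) * (1 / (A ^ 5 * (1 + A)\<^sup>2))"
      using that(1) B by (simp add: divide_simps power2_eq_square power3_eq_cube add_pos_pos less_imp_neq[symmetric])
    also have "\<dots> \<le> 1 * (1 / (A ^ 5 * (1 + A)\<^sup>2))"
      using 2 B that(1) by (intro mult_right_mono) auto
    finally show ?thesis by simp
  qed
  have "E * (((1 + A) / A ^ 5) * ((1 + B) / B ^ 5)) \<le> 1 / (A ^ 5 * (1 + A)\<^sup>2) + 1 / (B ^ 5 * (1 + B)\<^sup>2)"
  proof (cases "A \<le> B")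
    case True
    then have "\<kappa> \<le> B" using assms(4) by linarith
    from key[OF assms(2) True this] show ?thesis using assms(3) by (simp add: add_increasing2)
  next
    case False
    then have "B \<le> A" "\<kappa> \<le> A" using assms(4) by linarith+
    from key[OF assms(3) this] show ?thesis using assms(2)
      by (simp add: add_increasing mult.commute)
  qed
  moreover have E18: "\<kappa> / (18 * (1 + 1 / \<kappa>) ^ 4) = E / 18" by (simp add: E_def)
  ultimately show ?thesis unfolding E18 by simp
qed

text \<open>
  The density is \<open>\<surd>E (1 + a\<^bsup>1/3\<^esup>)\<^bsup>1/2\<^esup> a\<^bsup>-5/6\<^esup> (1 + b\<^bsup>1/3\<^esup>)\<^bsup>1/2\<^esup> b\<^bsup>-5/6\<^esup>\<close> with \<open>a = \<bar>w - p\<bar>\<close> and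
  \<open>b = \<bar>w - q\<bar>\<close>. The powers \<open>a\<^bsup>-5/6\<^esup>\<close> and \<open>b\<^bsup>-5/6\<^esup>\<close> are harmonic after taking logarithms; they
  balance the density against the Laplacian \<open>a\<^bsup>-5/3\<^esup> / (18 (1 + a\<^bsup>1/3\<^esup>)\<^sup>2)\<close> of
  \<open>1/2 log (1 + a\<^bsup>1/3\<^esup>)\<close> at the two punctures and make the square of the density
  \<open>O(\<bar>w\<bar>\<^bsup>-8/3\<^esup>)\<close> at infinity, where the Laplacian is only of order \<open>\<bar>w\<bar>\<^bsup>-7/3\<^esup>\<close>. So the
  curvature is bounded above by a negative constant, and \<open>E\<close> rescales it.
\<close>

lemma twice_punctured_SK_metric:
  fixes p q :: complex
  assumes pq: "p \<noteq> q" and G: "open G" "G \<noteq> {}" "p \<notin> G" "q \<notin> G"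
  obtains \<mu> where "SK_metric G \<mu>" "\<And>w. \<mu> w > 0"
proof -
  define \<psi> where "\<psi> = (\<lambda>s::real. 1 / 2 * ln (1 + exp (s / 3)) - 5 / 6 * s)"
  define \<psi>'' where "\<psi>'' = (\<lambda>s::real. 1 / 18 * (exp (s / 3) / (1 + exp (s / 3))\<^sup>2))"
  \<comment> \<open>every point has distance at least half of \<open>\<bar>p - q\<bar>\<close> from one of the punctures\<close>
  define \<kappa> where "\<kappa> = exp (ln (cmod (p - q) / 2) / 3)"
  define E where "E = \<kappa> / (18 * (1 + 1 / \<kappa>) ^ 4)"
  define v where "v = (\<lambda>w. (\<psi> (ln (cmod (w - p))) + \<psi> (ln (cmod (w - q)))) + ln E / 2)"
  have \<kappa>: "\<kappa> > 0" by (simp add: \<kappa>_def)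
  have "1 + 1 / \<kappa> > 0" using \<kappa> by (simp add: add_pos_pos)
  then have E: "E > 0" using \<kappa> by (simp add: E_def)
  have pos: "1 + exp (s / 3) > 0" for s :: real by (simp add: add_pos_pos)
  have ex1: "circle_expansion (\<lambda>w. \<psi> (ln (cmod (w - x)))) z
      (\<psi>'' (ln (cmod (z - x))) / (4 * (cmod (z - x))\<^sup>2))" if "z \<noteq> x" for z x
  proof (rule circle_expansion_log_radial[OF that, where
        f' = "\<lambda>s. 1 / 6 * (exp (s / 3) / (1 + exp (s / 3))) - 5 / 6"])
    have "(\<psi> has_real_derivative 1 / 6 * (exp (s / 3) / (1 + exp (s / 3))) - 5 / 6) (at s)" for s
      unfolding \<psi>_def using pos[of s] by (auto intro!: derivative_eq_intros simp: field_simps)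
    then show "\<forall>\<^sub>F s in nhds (ln (cmod (z - x))). (\<psi> has_real_derivative
        1 / 6 * (exp (s / 3) / (1 + exp (s / 3))) - 5 / 6) (at s)" by simp
    show "((\<lambda>s. 1 / 6 * (exp (s / 3) / (1 + exp (s / 3))) - 5 / 6) has_real_derivative
        \<psi>'' (ln (cmod (z - x)))) (at (ln (cmod (z - x))))"
    proof -
      let ?s = "ln (cmod (z - x))"
      have "((\<lambda>s. 1 / 6 * (exp (s / 3) / (1 + exp (s / 3))) - 5 / 6) has_real_derivative
          1 / 6 * ((exp (?s / 3) * (1 / 3) * (1 + exp (?s / 3)) - exp (?s / 3) * (exp (?s / 3) * (1 / 3)))
            / ((1 + exp (?s / 3)) * (1 + exp (?s / 3)))) - 0) (at ?s)"
        by (rule derivative_eq_intros refl | use pos[of ?s] in simp)+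
      moreover have "x * (1 / 3) * (1 + x) - x * (x * (1 / 3)) = x * (1 / 3)" for x :: real
        by (simp add: algebra_simps)
      ultimately have "((\<lambda>s. 1 / 6 * (exp (s / 3) / (1 + exp (s / 3))) - 5 / 6) has_real_derivative
          1 / 6 * (exp (?s / 3) * (1 / 3) / ((1 + exp (?s / 3)) * (1 + exp (?s / 3)))) - 0) (at ?s)"
        by (simp only:)
      then show ?thesis
        by (rule DERIV_cong) (simp add: \<psi>''_def power2_eq_square)
    qed
  qed
  have Gp: "w \<noteq> p" "w \<noteq> q" if "w \<in> G" for w using that G by auto
  have cont: "continuous_on G v"
    unfolding v_def \<psi>_def using Gp pos by (intro continuous_intros) (auto, (metis less_irrefl)+)
  have curv: "curvature (\<lambda>w. exp (v w)) z \<le> -1" if z: "z \<in> G" for z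
  proof -
    define a b A B where "a = cmod (z - p)" and "b = cmod (z - q)"
      and "A = exp (ln a / 3)" and "B = exp (ln b / 3)"
    have ab: "a > 0" "b > 0" using Gp[OF z] by (auto simp: a_def b_def)
    have AB: "A > 0" "B > 0" by (auto simp: A_def B_def)
    have A3: "a = A ^ 3" "b = B ^ 3" using ab by (simp_all add: A_def B_def exp_of_nat_mult[symmetric])
    have "cmod (p - q) \<le> a + b"
      using norm_triangle_ineq[of "p - z" "z - q"] by (simp add: a_def b_def norm_minus_commute)
    then have "cmod (p - q) / 2 \<le> a \<or> cmod (p - q) / 2 \<le> b" by linarith
    then have "\<kappa> \<le> A \<or> \<kappa> \<le> B"
      unfolding \<kappa>_def A_def B_def using pq ab by auto
    then have ineq: "E * (((1 + A) / A ^ 5) * ((1 + B) / B ^ 5))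
     \<le> (1 / (A ^ 5 * (1 + A)\<^sup>2) + 1 / (B ^ 5 * (1 + B)\<^sup>2)) / 18"
      unfolding E_def using twice_punctured_inequality[OF \<kappa> AB] by blast
    have \<psi>2: "(exp (\<psi> s))\<^sup>2 = (1 + exp (s / 3)) / (exp (s / 3)) ^ 5" for s
    proof -
      have "(exp (\<psi> s))\<^sup>2 = exp (2 * \<psi> s)" by (simp add: exp_double)
      also have "2 * \<psi> s = ln (1 + exp (s / 3)) - 5 * (s / 3)" by (simp add: \<psi>_def)
      also have "exp \<dots> = (1 + exp (s / 3)) / (exp (s / 3)) ^ 5"
        using pos[of s] exp_of_nat_mult[of 5 "s / 3"] by (simp add: exp_diff)
      finally show ?thesis .
    qed
    have \<psi>''A: "\<psi>'' (ln a) / a\<^sup>2 = 1 / (A ^ 5 * (1 + A)\<^sup>2) / 18"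
      unfolding \<psi>''_def A_def[symmetric] using AB unfolding A3
      by (simp add: field_simps power_mult[symmetric] power_Suc[symmetric] del: power_Suc)
    have \<psi>''B: "\<psi>'' (ln b) / b\<^sup>2 = 1 / (B ^ 5 * (1 + B)\<^sup>2) / 18"
      unfolding \<psi>''_def B_def[symmetric] using AB unfolding A3
      by (simp add: field_simps power_mult[symmetric] power_Suc[symmetric] del: power_Suc)
    obtain e where e: "e > 0" "ball z e \<subseteq> G" using G(1) z by (metis open_contains_ball)
    have ex: "circle_expansion v z ((\<psi>'' (ln a) / (4 * a\<^sup>2) + \<psi>'' (ln b) / (4 * b\<^sup>2)) + 0)"
      unfolding v_def a_def b_def using Gp[OF z]
      by (intro circle_expansion_add circle_expansion_const ex1) auto
    show ?thesis
    proof (rule curvature_exp_le[OF e(1) continuous_on_subset[OF cont e(2)] ex])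
      have "(exp (v z))\<^sup>2 = (exp (\<psi> (ln a)))\<^sup>2 * (exp (\<psi> (ln b)))\<^sup>2 * (exp (ln E / 2))\<^sup>2"
        by (simp add: v_def a_def b_def exp_add power_mult_distrib)
      also have "(exp (ln E / 2))\<^sup>2 = E" using E by (simp add: exp_double[symmetric])
      also have "(exp (\<psi> (ln a)))\<^sup>2 * (exp (\<psi> (ln b)))\<^sup>2 * E
           = E * (((1 + A) / A ^ 5) * ((1 + B) / B ^ 5))"
        unfolding \<psi>2 A_def B_def by simp
      also have "\<dots> \<le> \<psi>'' (ln a) / a\<^sup>2 + \<psi>'' (ln b) / b\<^sup>2"
        using ineq unfolding \<psi>''A \<psi>''B by (simp only: add_divide_distrib)
      finally show "(exp (v z))\<^sup>2 \<le> 4 * ((\<psi>'' (ln a) / (4 * a\<^sup>2) + \<psi>'' (ln b) / (4 * b\<^sup>2)) + 0)"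
        by simp
    qed
  qed
  show ?thesis
  proof (rule that)
    show "SK_metric G (\<lambda>w. exp (v w))"
      unfolding SK_metric_def conformal_pseudo_metric_def
      using curv cont G(2) by (auto intro!: continuous_intros)
  qed simp
qed

section \<open>Asymptotics at an isolated boundary point\<close>

text \<open>
  A punctured disc without frontier points is connected, hence lies on one side of the frontier; it
  meets \<open>G\<close> because \<open>z0\<close> is in the closure.
\<close>

lemma isolated_frontier_punctured_disc:
  fixes G :: "complex set"
  assumes "open G" "z0 isolated_in frontier G"
  obtains R where "R > 0" "cball z0 R - {z0} \<subseteq> G" "z0 \<notin> G"
proof -
  obtain T where T: "open T" "T \<inter> frontier G = {z0}"
    using assms(2) unfolding isolated_in_def by blast
  then have fr: "z0 \<in> frontier G" "z0 \<in> T" by auto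
  then have z0: "z0 \<notin> G" using assms(1) by (auto simp: frontier_def interior_open)
  obtain r where r: "r > 0" "ball z0 r \<subseteq> T" using T(1) fr(2) by (metis open_contains_ball)
  have con: "connected (ball z0 r - {z0})" by (rule connected_punctured_ball) simp
  have "z0 \<in> closure G" using fr by (simp add: frontier_def)
  then obtain y where "y \<in> G" "dist y z0 < r" using r(1) closure_approachable by metis
  then have "y \<in> (ball z0 r - {z0}) \<inter> G" using z0 by (auto simp: dist_commute)
  then have "(ball z0 r - {z0}) \<inter> G \<noteq> {}" by blast
  moreover have "(ball z0 r - {z0}) \<inter> frontier G = {}" using T(2) r(2) by auto
  ultimately have "ball z0 r - {z0} \<subseteq> G" using connected_Int_frontier[OF con] by blast
  moreover have "cball z0 (r / 2) \<subseteq> ball z0 r" using r(1) by auto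
  ultimately show ?thesis using r(1) z0 by (intro that[of "r / 2"]) auto
qed

text \<open>
  The cusp density is finite and positive on the closed punctured disc as soon as \<open>M > log R\<close>, and its
  value on the bounding circle decreases to 0 as \<open>M\<close> grows. So it can be pushed below the
  positive minimum of \<open>\<mu>\<close> on that circle and glued into \<open>\<mu>\<close>.
\<close>

lemma cusp_lower_bound:
  assumes G: "open G" "G \<noteq> {}" and p: "p \<notin> G" and R: "R > 0" and sub: "cball p R - {p} \<subseteq> G"
    and sk: "SK_metric G \<mu>" and pos: "\<And>w. w \<in> G \<Longrightarrow> \<mu> w > 0"
  obtains \<sigma> M where "SK_metric G \<sigma>"
    "\<And>z. z \<noteq> p \<Longrightarrow> cmod (z - p) \<le> R \<Longrightarrow>
        ln (cmod (z - p)) < M \<and> 1 \<le> \<sigma> z * cmod (z - p) * (M - ln (cmod (z - p)))"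
proof -
  have c: "continuous_on G \<mu>" using sk by (auto simp: SK_metric_def conformal_pseudo_metric_def)
  have sp: "sphere p R \<subseteq> G" using sub R by auto
  have "sphere p R \<noteq> {}" using R by simp
  then obtain w0 where w0: "w0 \<in> sphere p R" and mn: "\<And>w. w \<in> sphere p R \<Longrightarrow> \<mu> w0 \<le> \<mu> w"
    using continuous_attains_inf[OF compact_sphere _ continuous_on_subset[OF c sp]] by metis
  define m where "m = \<mu> w0"
  have m: "m > 0" using pos w0 sp by (auto simp: m_def)
  \<comment> \<open>chosen so that the cusp density equals \<open>m\<close> on the circle of radius \<open>R\<close>\<close>
  define M where "M = ln R + 1 / (R * m)"
  define \<nu> where "\<nu> = (\<lambda>w. exp (- ln (cmod (w - p)) - ln (M - ln (cmod (w - p)))))"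
  define \<sigma> where "\<sigma> = (\<lambda>w. if w \<in> cball p R then max (\<mu> w) (\<nu> w) else \<mu> w)"
  have sM: "ln (cmod (w - p)) < M" if "w \<noteq> p" "cmod (w - p) \<le> R" for w
  proof -
    have "ln (cmod (w - p)) \<le> ln R" using that R by simp
    also have "\<dots> < M" using R m by (simp add: M_def)
    finally show ?thesis .
  qed
  have cmod_le: "w \<in> cball p R \<longleftrightarrow> cmod (w - p) \<le> R" for w
    by (simp add: dist_norm norm_minus_commute)
  have "SK_metric G \<sigma>"
    unfolding \<sigma>_def
  proof (rule SK_metric_glue[OF G(1) closed_cball sk])
    have ne: "w \<noteq> p" "ln (cmod (w - p)) \<noteq> M" if "w \<in> G \<inter> cball p R" for w
      using that p sM[of w] cmod_le[of w] by auto
    show "continuous_on (G \<inter> cball p R) \<nu>"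
      unfolding \<nu>_def by (intro continuous_intros) (use ne in force)+
    show "\<nu> w \<le> \<mu> w" if "w \<in> G" "w \<in> frontier (cball p R)" for w
    proof -
      have w: "w \<in> sphere p R" using that R by (simp add: frontier_cball)
      then have "cmod (w - p) = R" by (simp add: dist_norm norm_minus_commute)
      then have "\<nu> w = m" using R m by (simp add: \<nu>_def M_def exp_diff exp_minus field_simps)
      then show ?thesis using mn[OF w] by (simp add: m_def)
    qed
    show "curvature \<nu> w \<le> -1" if "w \<in> G" "w \<in> interior (cball p R)" for w
    proof -
      have "w \<noteq> p" "cmod (w - p) \<le> R"
        using that p interior_subset cmod_le by blast+
      then show ?thesis unfolding \<nu>_def by (intro cusp_curvature sM)
    qed
  qed
  moreover have "ln (cmod (z - p)) < M \<and> 1 \<le> \<sigma> z * cmod (z - p) * (M - ln (cmod (z - p)))"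
    if z: "z \<noteq> p" "cmod (z - p) \<le> R" for z
  proof
    show s: "ln (cmod (z - p)) < M" by (rule sM[OF z])
    let ?k = "cmod (z - p) * (M - ln (cmod (z - p)))"
    have k: "?k > 0" using z s by simp
    have "\<nu> z = 1 / ?k" using z s by (simp add: \<nu>_def exp_diff exp_minus field_simps)
    then have "1 = \<nu> z * ?k" using k by (metis less_irrefl nonzero_divide_eq_eq)
    also have "\<dots> \<le> \<sigma> z * ?k"
      using k z cmod_le by (intro mult_right_mono) (auto simp: \<sigma>_def)
    finally show "1 \<le> \<sigma> z * cmod (z - p) * (M - ln (cmod (z - p)))" by (simp add: mult.assoc)
  qed
  ultimately show ?thesis by (rule that)
qed

theorem corollary4p16:
  fixes G :: "complex set" and z0 :: complex
  assumes "open G" and "connected G" and "G \<noteq> {}"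
    and "z0 isolated_in frontier G"
    and "has_hyperbolic_metric G"
  shows "((\<lambda>z. (cmod (z - z0) * ln (1 / cmod (z - z0))) * hyperbolic_metric G z) \<longlongrightarrow> 1)
           (at z0 within G)"
proof -
  obtain R where R: "R > 0" and sub: "cball z0 R - {z0} \<subseteq> G" and z0: "z0 \<notin> G"
    using isolated_frontier_punctured_disc[OF assms(1,4)] by blast
  obtain \<mu> where \<mu>: "SK_metric G \<mu>" using assms(5) by (auto simp: has_hyperbolic_metric_def)
  obtain z1 where z1: "z1 \<noteq> z0" "z1 \<notin> G" using no_SK_metric_punctured_plane[OF \<mu>] by auto
  obtain \<tau> where \<tau>: "SK_metric G \<tau>" "\<And>w. \<tau> w > 0"
    using twice_punctured_SK_metric[OF z1(1)[symmetric] assms(1,3) z0 z1(2)] by blast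
  obtain \<sigma> M where \<sigma>: "SK_metric G \<sigma>"
    and low: "\<And>z. z \<noteq> z0 \<Longrightarrow> cmod (z - z0) \<le> R \<Longrightarrow>
        ln (cmod (z - z0)) < M \<and> 1 \<le> \<sigma> z * cmod (z - z0) * (M - ln (cmod (z - z0)))"
    using cusp_lower_bound[OF assms(1,3) z0 R sub \<tau>(1)] \<tau>(2) by metis
  define a where "a = (\<lambda>z. cmod (z - z0))"
  define f where "f = (\<lambda>z. (a z * ln (1 / a z)) * hyperbolic_metric G z)"
  have bounds: "- ln (a z) / (M - ln (a z)) \<le> f z \<and> f z \<le> - ln (a z) / (ln R - ln (a z))"
    if z: "0 < a z" "a z < R" "a z < 1" for z
  proof -
    have zz: "z \<noteq> z0" "cmod (z - z0) \<le> R" using z by (auto simp: a_def)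
    have az: "cmod (z - z0) = a z" by (simp add: a_def)
    have lR: "ln R - ln (a z) > 0" using z R by simp
    have up: "\<nu> z \<le> 1 / (a z * (ln R - ln (a z)))" if "SK_metric G \<nu>" for \<nu>
    proof -
      have "\<nu> z * a z * ln (R / a z) \<le> 1"
        using SK_metric_le_punctured_disc[OF that R sub zz] by (simp only: a_def)
      then show ?thesis using z lR R by (simp add: ln_div pos_le_divide_eq mult.assoc)
    qed
    have "hyperbolic_metric G z \<le> 1 / (a z * (ln R - ln (a z)))"
      unfolding hyperbolic_metric_def by (rule cSup_least) (use \<mu> up in auto)
    moreover have "\<sigma> z \<le> hyperbolic_metric G z"
      unfolding hyperbolic_metric_def
      by (rule cSup_upper) (use \<sigma> up in \<open>auto intro!: bdd_aboveI\<close>)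
    moreover have lM: "M - ln (a z) > 0" and "1 / (a z * (M - ln (a z))) \<le> \<sigma> z"
      using low[OF zz, unfolded az] z by (auto simp: pos_divide_le_eq mult.assoc)
    moreover have "a z * ln (1 / a z) = a z * (- ln (a z))" "0 \<le> a z * (- ln (a z))"
      using z by (auto simp: ln_div mult_nonneg_nonpos)
    ultimately have
      "(a z * (- ln (a z))) * (1 / (a z * (M - ln (a z)))) \<le> f z"
      "f z \<le> (a z * (- ln (a z))) * (1 / (a z * (ln R - ln (a z))))"
      unfolding f_def by (simp only:, intro mult_left_mono; linarith)+
    then show ?thesis using z by simp
  qed
  have a0: "filterlim a (at_right 0) (at z0 within G)"
  proof -
    have "(a \<longlongrightarrow> 0) (at z0 within G)"
      unfolding a_def by (rule tendsto_eq_intros refl | simp)+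
    then show ?thesis
      by (auto simp: filterlim_at a_def eventually_at_filter)
  qed
  have ev: "\<forall>\<^sub>F z in at z0 within G. 0 < a z \<and> a z < R \<and> a z < 1"
  proof -
    have "\<forall>\<^sub>F x in at_right (0::real). 0 < x \<and> x < R \<and> x < 1"
      using R by (auto simp: eventually_at_right_field intro!: exI[of _ "min R 1"])
    then show ?thesis using a0 by (auto simp: filterlim_iff)
  qed
  have lim: "((\<lambda>z. - ln (a z) / (K - ln (a z))) \<longlongrightarrow> 1) (at z0 within G)" for K
  proof (rule filterlim_compose[OF _ a0])
    show "((\<lambda>x. - ln x / (K - ln x)) \<longlongrightarrow> 1) (at_right 0)" by real_asymp
  qed
  have "(f \<longlongrightarrow> 1) (at z0 within G)"
    by (rule tendsto_sandwich[OF _ _ lim[of M] lim[of "ln R"]])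
       (use ev bounds in \<open>auto elim!: eventually_mono\<close>)
  then show ?thesis by (simp add: f_def a_def)
qed

end
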